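(* Let $n\ge 1$ be an integer, and let $G$ be either an infinite $\delta$-regular tree, or a finite $\delta$-regular graph of order $m$ with girth greater than $2n$. Let $v$ be a vertex of $G$. Then the number $W_{2n}$ of closed walks of length $2n$ at $v$ in $G$ (walks of length $2n$ that start and end at $v$) is $$W_{2n}=\sum_{\ell=1}^{n}(-1)^{n-\ell}B_{n-1,n-\ell}\,\delta^{\ell}=\sum_{\ell=0}^{n-1}(-1)^{\ell}B_{n-1,\ell}\,\delta^{n-\ell},$$ where $B_{n,k}$ denotes the entries of Borel's triangle.
   Context: Graphs are simple and undirected, and $\delta$ is a (finite) integer. Catalan's triangle: for integers $0\le k\le n$, $C_{n,k}$ is the number of lattice paths in the coordinate plane (with unit steps right and up) from $(0,0)$ to $(n,k)$ that do not go above the line $y=x$; explicitly $C_{n,k}=\frac{n-k+1}{n+1}\binom{n+k}{n}$. Borel's triangle is the array $\{B_{n,k}: 0\le k\le n\}$ defined by $B_{n,k}=\sum_{s=k}^{n}\binom{s}{k}C_{n,s}$. *)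

theory Defs
  imports Complex_Main "HOL-Library.Extended_Nat" "Graph_Theory.Graph_Theory"
begin

section \<open>Catalan's triangle and Borel's triangle\<close>

datatype step = Rt | Up

definition lattice_paths :: "nat \<Rightarrow> nat \<Rightarrow> step list set" where
  "lattice_paths n k =
     {p. count_list p Rt = n \<and> count_list p Up = k \<and>
         (\<forall>i \<le> length p. count_list (take i p) Up \<le> count_list (take i p) Rt)}"

definition catalan_triangle :: "nat \<Rightarrow> nat \<Rightarrow> nat" where
  "catalan_triangle n k = card (lattice_paths n k)"

definition borel_triangle :: "nat \<Rightarrow> nat \<Rightarrow> nat" where
  "borel_triangle n k = (\<Sum>s = k..n. (s choose k) * catalan_triangle n s)"

lemma length_eq_count_steps: "length p = count_list p Rt + count_list p Up"
proof (induction p)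
  case (Cons a p) then show ?case by (cases a) auto
qed simp

lemma finite_lattice_paths: "finite (lattice_paths n k)"
proof (rule finite_subset)
  show "lattice_paths n k \<subseteq> {p. set p \<subseteq> {Rt, Up} \<and> length p = n + k}"
  proof
    fix p assume "p \<in> lattice_paths n k"
    moreover have "set p \<subseteq> {Rt, Up}" using step.exhaust by blast
    ultimately show "p \<in> {p. set p \<subseteq> {Rt, Up} \<and> length p = n + k}"
      by (simp add: lattice_paths_def length_eq_count_steps)
  qed
  show "finite {p. set p \<subseteq> {Rt, Up} \<and> length p = n + k}"
    by (rule finite_lists_length_eq) simp
qed

lemma snoc_in_lattice_paths:
  "p @ [a] \<in> lattice_paths n k \<longleftrightarrow>
     p \<in> lattice_paths (count_list p Rt) (count_list p Up) \<and>
     count_list (p @ [a]) Rt = n \<and> count_list (p @ [a]) Up = k \<and> k \<le> n"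
  by (auto simp: lattice_paths_def le_Suc_eq)

lemma lattice_paths_above: "n < k \<Longrightarrow> lattice_paths n k = {}"
  by (auto simp: lattice_paths_def dest: spec[where x = "length p" for p :: "step list"])

lemma lattice_paths_0: "lattice_paths n 0 = {replicate n Rt}"
proof -
  have "p = replicate n Rt" if "p \<in> lattice_paths n 0" for p
  proof -
    have "length p = n" "Up \<notin> set p"
      using that by (auto simp: lattice_paths_def length_eq_count_steps count_list_0_iff)
    moreover from this have "\<forall>x \<in> set p. x = Rt" by (metis step.exhaust)
    ultimately show ?thesis by (simp add: replicate_eqI)
  qed
  moreover have "replicate n Rt \<in> lattice_paths n 0"
    by (auto simp: lattice_paths_def count_list_0_iff length_eq_count_steps[symmetric]
        intro: trans[OF _ length_replicate[of n Rt]])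
      (metis add.right_neutral count_list_0_iff in_set_replicate length_eq_count_steps
        length_replicate step.distinct(1))
  ultimately show ?thesis by blast
qed

lemma lattice_paths_Suc_Suc:
  assumes "k \<le> n"
  shows "lattice_paths (Suc n) (Suc k) =
     (\<lambda>p. p @ [Rt]) ` lattice_paths n (Suc k) \<union> (\<lambda>p. p @ [Up]) ` lattice_paths (Suc n) k"
    (is "?L = ?R")
proof
  show "?L \<subseteq> ?R"
  proof
    fix q assume q: "q \<in> ?L"
    then have "q \<noteq> []" by (auto simp: lattice_paths_def)
    then obtain p a where pa: "q = p @ [a]" by (metis rev_exhaust)
    show "q \<in> ?R" using q unfolding pa snoc_in_lattice_paths by (cases a) auto
  qed
  show "?R \<subseteq> ?L"
  proof -
    have "p \<in> lattice_paths a b \<Longrightarrow> count_list p Rt = a \<and> count_list p Up = b" for p a b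
      by (simp add: lattice_paths_def)
    then show ?thesis using assms by (force simp: snoc_in_lattice_paths)
  qed
qed

lemma catalan_triangle_0 [simp]: "catalan_triangle n 0 = 1"
  by (simp add: catalan_triangle_def lattice_paths_0)

lemma catalan_triangle_above: "n < k \<Longrightarrow> catalan_triangle n k = 0"
  by (simp add: catalan_triangle_def lattice_paths_above)

lemma catalan_triangle_Suc_Suc:
  assumes "k \<le> n"
  shows "catalan_triangle (Suc n) (Suc k) =
    catalan_triangle n (Suc k) + catalan_triangle (Suc n) k"
  unfolding catalan_triangle_def lattice_paths_Suc_Suc[OF assms]
  by (subst card_Un_disjoint) (auto simp: finite_lattice_paths card_image inj_on_def)

lemma catalan_triangle_closed_form:
  assumes "k \<le> Suc n"
  shows "real (catalan_triangle n k) = (real n - real k + 1) / (real n + 1) * real ((n + k) choose n)"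
  using assms
proof (induction "n + k" arbitrary: n k)
  case 0 then show ?case by simp
next
  case (Suc m)
  show ?case
  proof (cases k)
    case 0 then show ?thesis by simp
  next
    case k: (Suc j)
    show ?thesis
    proof (cases "k = Suc n")
      case True then show ?thesis by (simp add: catalan_triangle_above)
    next
      case False
      with Suc.prems k obtain i where n: "n = Suc i" and ji: "j \<le> i" by (cases n) auto
      define x y where "x = real ((i + k) choose i)" and "y = real ((n + j) choose n)"
      have IH1: "real (catalan_triangle i k) = (real i - real k + 1) / (real i + 1) * x"
        unfolding x_def by (rule Suc.hyps(1)) (use Suc.hyps(2) n k ji in auto)
      have IH2: "real (catalan_triangle n j) = (real n - real j + 1) / (real n + 1) * y"
        unfolding y_def by (rule Suc.hyps(1)) (use Suc.hyps(2) n k ji in auto)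
      have "Suc i * (Suc (i + j) choose Suc i) = (Suc (i + j) - i) * (Suc (i + j) choose i)"
        using binomial_absorb_comp[of "Suc (i + j)" i] binomial_absorption[of i "Suc (i + j)"] by simp
      then have "(real i + 1) * y = (real j + 1) * x"
        unfolding x_def y_def n k
        by (metis Suc_diff_le add_Suc add_Suc_right diff_add_inverse le_add1 of_nat_Suc
            of_nat_mult add.commute)
      then have x: "x = (real i + 1) * y / (real j + 1)" by (simp add: field_simps)
      have "real ((n + k) choose n) = x + y"
        by (simp add: n k x_def y_def)
      moreover have "real (catalan_triangle n k) =
          real (catalan_triangle i k) + real (catalan_triangle n j)"
        using catalan_triangle_Suc_Suc[OF ji] by (simp add: n k)
      moreover have "(real i - (real j + 1) + 1) / (real i + 1) * x
          + (real i + 1 - real j + 1) / (real i + 1 + 1) * y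
        = (real i + 1 - (real j + 1) + 1) / (real i + 1 + 1) * (x + y)"
      proof -
        have "real i + 1 > 0" "real i + 2 > 0" "real j + 1 > 0" by simp_all
        then show ?thesis unfolding x by (simp add: divide_simps) (simp add: algebra_simps)
      qed
      ultimately show ?thesis using IH1 IH2 by (simp add: n k add_ac)
    qed
  qed
qed


section \<open>Graphs\<close>

text \<open>
  A simple undirected graph, finite or not, is a symmetric irreflexive relation on its vertex set;
  this is the locale \<^locale>\<open>pair_bidirected_digraph\<close>. Every edge \<open>{u, w}\<close> is represented by its two
  orientations \<open>(u, w)\<close> and \<open>(w, u)\<close>, so the degree of a vertex is its out-degree.

  The library's \<open>cycle\<close> also admits \<open>u, w, u\<close>, which traverses one undirected edge twice.
  Requiring length at least three leaves exactly the cycles of the undirected graph. For the same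
  reason the library's \<open>forest\<close> and \<open>tree\<close>, based on directed cycles, are not used here.
\<close>

definition regular :: "'a pair_pre_digraph \<Rightarrow> nat \<Rightarrow> bool" where
  "regular G d \<longleftrightarrow> (\<forall>v \<in> pverts G. finite (out_arcs G v) \<and> out_degree G v = d)"

definition undirected_cycle :: "'a pair_pre_digraph \<Rightarrow> ('a \<times> 'a) awalk \<Rightarrow> bool" where
  "undirected_cycle G p \<longleftrightarrow> pre_digraph.cycle G p \<and> 3 \<le> length p"

definition undirected_tree :: "'a pair_pre_digraph \<Rightarrow> bool" where
  "undirected_tree G \<longleftrightarrow> connected G \<and> (\<nexists>p. undirected_cycle G p)"

text \<open>The girth of an acyclic graph is \<open>\<infinity>\<close>, the infimum of the empty set.\<close>

definition girth :: "'a pair_pre_digraph \<Rightarrow> enat" where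
  "girth G = (INF p \<in> {p. undirected_cycle G p}. enat (length p))"

definition closed_walks :: "'a pair_pre_digraph \<Rightarrow> 'a \<Rightarrow> nat \<Rightarrow> ('a \<times> 'a) awalk set" where
  "closed_walks G v k = {p. pre_digraph.awalk G v p v \<and> length p = k}"

end

theory Submission
  imports Defs
begin

text \<open>
  Up to length \<open>2n\<close> the graph looks like a tree: two non-backtracking walks with common ends and
  total length at most \<open>2n\<close> coincide, for otherwise they would enclose a short cycle. Hence a
  vertex at distance \<open>k\<close> from \<open>v\<close>, \<open>0 < k < n\<close>, has one neighbour at distance \<open>k - 1\<close> and all
  others at distance \<open>k + 1\<close>. So the number of walks to \<open>v\<close> of length \<open>k + 2i\<close> depends only on the
  distance \<open>k\<close> of the starting point, and the recurrence of Catalan's triangle shows that it is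
  \<open>\<Sum>s\<le>i. C\<^bsub>i+k-1,s\<^esub> (\<delta>-1)\<^sup>s \<delta>\<^sup>i\<^sup>-\<^sup>s\<close>. Expanding the powers of \<open>\<delta> - 1\<close> turns Catalan's triangle
  into Borel's triangle.
\<close>

section \<open>Walks and distances\<close>

text \<open>In a walk the second arc \<open>f\<close> starts where \<open>e\<close> ends, so the
  condition says that \<open>f\<close> is not the reversal of \<open>e\<close>.\<close>

definition nonbacktracking :: "('a \<times> 'a) awalk \<Rightarrow> bool" where
  "nonbacktracking p \<longleftrightarrow> successively (\<lambda>e f. snd f \<noteq> fst e) p"

lemma nonbacktracking_Nil [simp]: "nonbacktracking []"
  by (simp add: nonbacktracking_def)

lemma nonbacktracking_Cons:
  "nonbacktracking (e # p) \<longleftrightarrow> p = [] \<or> snd (hd p) \<noteq> fst e \<and> nonbacktracking p"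
  by (auto simp: nonbacktracking_def successively_Cons)

lemma nonbacktracking_append:
  "nonbacktracking (p @ q) \<longleftrightarrow> nonbacktracking p \<and> nonbacktracking q \<and>
     (p = [] \<or> q = [] \<or> snd (hd q) \<noteq> fst (last p))"
  by (auto simp: nonbacktracking_def successively_append_iff)

lemma rev_path_conv: "rev_path p = rev (map prod.swap p)"
  by (induction p) (auto simp: prod.swap_def)

lemma nonbacktracking_rev_path: "nonbacktracking (rev_path p) \<longleftrightarrow> nonbacktracking p"
  by (auto simp: nonbacktracking_def rev_path_conv successively_map eq_commute)

definition walks :: "'a pair_pre_digraph \<Rightarrow> 'a \<Rightarrow> 'a \<Rightarrow> nat \<Rightarrow> ('a \<times> 'a) awalk set" where
  "walks G u v k = {p. pre_digraph.awalk G u p v \<and> length p = k}"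

lemma closed_walks_eq_walks: "closed_walks G v k = walks G v v k"
  by (simp add: closed_walks_def walks_def)

text \<open>The value is unspecified if no walk from \<open>u\<close> to \<open>v\<close> exists,
  which is why \<open>shortest_walk\<close> assumes one.\<close>

definition walk_dist :: "'a pair_pre_digraph \<Rightarrow> 'a \<Rightarrow> 'a \<Rightarrow> nat" where
  "walk_dist G u v = (LEAST k. walks G u v k \<noteq> {})"

definition neighbours :: "'a pair_pre_digraph \<Rightarrow> 'a \<Rightarrow> 'a set" where
  "neighbours G u = {w. (u, w) \<in> parcs G}"

lemma regular_neighbours:
  assumes "regular G d" "u \<in> pverts G"
  shows "finite (neighbours G u)" "card (neighbours G u) = d"
proof -
  have arcs: "out_arcs G u = Pair u ` neighbours G u"
    by (auto simp: out_arcs_def neighbours_def)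
  have inj: "inj_on (Pair u) (neighbours G u)" by (simp add: inj_on_def)
  show "finite (neighbours G u)"
    using assms arcs finite_imageD[OF _ inj] by (auto simp: regular_def)
  show "card (neighbours G u) = d"
    using assms arcs card_image[OF inj] by (auto simp: regular_def out_degree_def)
qed

context pair_bidirected_digraph
begin

lemma walks_0: "walks G u v 0 = (if u = v \<and> u \<in> pverts G then {[]} else {})"
  by (auto simp: walks_def awalk_Nil_iff)

lemma walks_Suc: "walks G u v (Suc k) = (\<Union>w \<in> neighbours G u. (#) (u, w) ` walks G w v k)"
  by (force simp: walks_def neighbours_def awalk_Cons_iff length_Suc_conv)

lemma finite_walks:
  assumes "regular G d"
  shows "finite (walks G u v k)"
proof (induction k arbitrary: u)
  case (Suc k)
  show ?case
  proof (cases "u \<in> pverts G")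
    case True
    then show ?thesis
      using Suc regular_neighbours[OF assms] by (simp add: walks_Suc)
  next
    case False
    then have "neighbours G u = {}" by (auto simp: neighbours_def dest: in_arcsD1)
    then show ?thesis by (simp add: walks_Suc)
  qed
qed (simp add: walks_0)

lemma card_walks_Suc:
  assumes "regular G d" "u \<in> pverts G"
  shows "card (walks G u v (Suc k)) = (\<Sum>w \<in> neighbours G u. card (walks G w v k))"
  unfolding walks_Suc
  by (subst card_UN_disjoint)
    (auto simp: finite_walks[OF assms(1)] regular_neighbours[OF assms] card_image)

lemma walk_dist_le: "awalk u p v \<Longrightarrow> walk_dist G u v \<le> length p"
  unfolding walk_dist_def by (rule Least_le) (auto simp: walks_def)

lemma shortest_walk:
  assumes "awalk u p v"
  obtains q where "awalk u q v" "length q = walk_dist G u v"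
proof -
  have "walks G u v (walk_dist G u v) \<noteq> {}"
    unfolding walk_dist_def by (rule LeastI[of _ "length p"]) (use assms in \<open>auto simp: walks_def\<close>)
  then show thesis using that by (auto simp: walks_def)
qed

lemma walks_less_dist: "k < walk_dist G u v \<Longrightarrow> walks G u v k = {}"
  unfolding walk_dist_def using not_less_Least by blast

lemma walk_dist_neighbour:
  assumes "awalk u p v" "w \<in> neighbours G u"
  shows "walk_dist G w v \<le> Suc (walk_dist G u v)" "walk_dist G u v \<le> Suc (walk_dist G w v)"
    "\<exists>q. awalk w q v"
proof -
  have arcs: "(u, w) \<in> parcs G" "(w, u) \<in> parcs G"
    using assms(2) arcs_symmetric by (auto simp: neighbours_def)
  obtain q where q: "awalk u q v" "length q = walk_dist G u v" using shortest_walk[OF assms(1)] .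
  have 1: "awalk w ((w, u) # q) v" using arcs q by (simp add: awalk_Cons_iff)
  show "walk_dist G w v \<le> Suc (walk_dist G u v)" "\<exists>q. awalk w q v"
    using walk_dist_le[OF 1] q 1 by auto
  obtain r where r: "awalk w r v" "length r = walk_dist G w v" using shortest_walk[OF 1] .
  have "awalk u ((u, w) # r) v" using arcs r by (simp add: awalk_Cons_iff)
  from walk_dist_le[OF this] show "walk_dist G u v \<le> Suc (walk_dist G w v)" using r by simp
qed

text \<open>Deleting a backtrack would give a walk with the same ends that is two arcs shorter. The
  induction works because the tail of a shortest walk is again shortest.\<close>

lemma shortest_walk_nonbacktracking:
  "awalk u p v \<Longrightarrow> length p = walk_dist G u v \<Longrightarrow> nonbacktracking p"
proof (induction p arbitrary: u)
  case Nil
  show ?case by simp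
next
  case (Cons e p)
  have e: "e \<in> parcs G" "fst e = u" "awalk (snd e) p v"
    using Cons.prems by (auto simp: awalk_Cons_iff)
  then have "snd e \<in> neighbours G u" by (auto simp: neighbours_def)
  with walk_dist_neighbour(2)[OF Cons.prems(1)] walk_dist_le[OF e(3)] Cons.prems(2)
  have "length p = walk_dist G (snd e) v" by fastforce
  with Cons.IH e(3) have p: "nonbacktracking p" by blast
  have "snd (hd p) \<noteq> fst e" if "p \<noteq> []"
  proof
    assume "snd (hd p) = fst e"
    moreover obtain f q where "p = f # q" using \<open>p \<noteq> []\<close> by (cases p) auto
    ultimately have "awalk u q v" "length q < length p" using e by (auto simp: awalk_Cons_iff)
    with walk_dist_le[of u q v] Cons.prems(2) show False by simp
  qed
  with p show ?case by (auto simp: nonbacktracking_Cons)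
qed

section \<open>Short cycles\<close>

text \<open>If a vertex still repeats after removal of the first or of the last arc, the shorter
  walk yields the cycle. Otherwise the walk is itself a cycle, and the absence of loops and
  backtracks rules out lengths 1 and 2.\<close>

lemma nonbacktracking_imp_cycle:
  assumes "awalk u p w" "nonbacktracking p" "\<not> distinct (awalk_verts u p)"
  shows "\<exists>c. undirected_cycle G c \<and> length c \<le> length p"
  using assms
proof (induction "length p" arbitrary: u p w rule: less_induct)
  case less
  have "p \<noteq> []" using less.prems(3) by auto
  then obtain e es where p: "p = e # es" by (cases p) auto
  obtain bs l where p': "p = bs @ [l]" using \<open>p \<noteq> []\<close> by (metis rev_exhaust)
  have es: "awalk (snd e) es w" "nonbacktracking es" and e: "e \<in> parcs G" "fst e = u"
    using less.prems unfolding p by (auto simp: awalk_Cons_iff nonbacktracking_Cons)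
  have bs: "awalk u bs (awlast u bs)" "nonbacktracking bs"
    using less.prems unfolding p' by (auto simp: nonbacktracking_append)
  have l: "snd l = w" using less.prems(1) unfolding p' by (simp add: awalk_simps)
  show ?case
  proof (cases "distinct (awalk_verts (snd e) es) \<and> distinct (awalk_verts u bs)")
    case False
    then show ?thesis
      using less.hyps[OF _ es] less.hyps[OF _ bs] p p'
      by (metis length_Cons length_append_singleton less_Suc_eq_le less_imp_le nle_le lessI order.trans)
  next
    case True
    obtain xs where bs_verts: "awalk_verts u bs = u # xs"
      using bs(1) by (metis awhd_of_awalk awalk_verts_non_Nil list.collapse)
    \<comment> \<open>The vertices of \<open>p\<close> are \<open>u # xs @ [w]\<close>, with
      \<open>u # xs\<close> and \<open>xs @ [w]\<close> both distinct; the only possible repetition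
      is \<open>u = w\<close>.\<close>
    have "awalk_verts u p = awalk_verts u bs @ [w]"
      using less.prems(1) l unfolding p' by (subst awalk_verts_append) auto
    then have "awalk_verts (snd e) es = xs @ [w]" using p e bs_verts by simp
    moreover have "u \<in> set (awalk_verts (snd e) es)" using less.prems(3) True p e by auto
    ultimately have "u = w" using True bs_verts by auto
    then have cyc: "cycle p" using less.prems(1) True p unfolding cycle_def by auto
    have "length p \<noteq> 1"
    proof
      assume "length p = 1"
      then have "es = []" using p by simp
      then have "snd e = fst e" using es e \<open>u = w\<close> by (simp add: awalk_Nil_iff)
      then show False using pair_no_loops[OF e(1)] by simp
    qed
    moreover have "length p \<noteq> 2"
    proof
      assume "length p = 2"
      then have "es = [l]" using p p' by (cases es) auto
      then show False using less.prems(2) p l e \<open>u = w\<close> by (auto simp: nonbacktracking_Cons)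
    qed
    \<comment> \<open>The rule serves only for its case split into lists of length 0, 1 and at least
      2.\<close>
    ultimately have "3 \<le> length p" using \<open>p \<noteq> []\<close> by (cases p rule: remdups_adj.cases) (auto simp: Suc_le_eq)
    then show ?thesis using cyc by (auto simp: undirected_cycle_def)
  qed
qed

text \<open>Common first arcs are stripped off. If the walks then part, running back along one and
  out along the other is a closed non-backtracking walk of length at most \<open>N\<close>; if only
  one is exhausted, the other is such a walk. Either contains a forbidden cycle.\<close>

lemma nonbacktracking_unique:
  assumes no_cycle: "\<And>c. undirected_cycle G c \<Longrightarrow> N < length c"
    and "awalk u p v" "nonbacktracking p" "awalk u q v" "nonbacktracking q"
    and "length p + length q \<le> N"
  shows "p = q"
  using assms(2-)
proof (induction p arbitrary: u q)
  case Nil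
  show ?case
  proof (rule ccontr)
    assume "[] \<noteq> q"
    then obtain e es where q: "q = e # es" by (cases q) auto
    have "v \<in> set (awalk_verts (snd e) es)"
      using Nil q by (auto simp: awalk_simps)
        (metis awalk_verts_non_Nil awlast_of_awalk last_in_set awalkE)
    then have "\<not> distinct (awalk_verts u q)" using Nil q by (auto simp: awalk_simps)
    from nonbacktracking_imp_cycle[OF Nil.prems(3,4) this] no_cycle Nil.prems(5) show False
      by fastforce
  qed
next
  case (Cons e es)
  show ?case
  proof (cases q)
    case Nil
    have "v \<in> set (awalk_verts (snd e) es)"
      using Cons.prems Nil by (auto simp: awalk_simps)
        (metis awalk_verts_non_Nil awlast_of_awalk last_in_set awalkE)
    then have "\<not> distinct (awalk_verts u (e # es))" using Cons.prems Nil by (auto simp: awalk_simps)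
    from nonbacktracking_imp_cycle[OF Cons.prems(1,2) this] no_cycle Cons.prems(5) show ?thesis
      by fastforce
  next
    case q: (Cons f fs)
    have fst: "fst e = u" "fst f = u" using Cons.prems q by (auto simp: awalk_Cons_iff)
    show ?thesis
    proof (cases "snd e = snd f")
      case True
      then have "e = f" using fst by (simp add: prod_eq_iff)
      moreover have "es = fs"
        by (rule Cons.IH[of "snd e"])
          (use Cons.prems q True in \<open>auto simp: awalk_Cons_iff nonbacktracking_Cons\<close>)
      ultimately show ?thesis using q by simp
    next
      case False
      \<comment> \<open>At the junction the reversal of \<open>e\<close>, starting at
        \<open>snd e\<close>, is followed by \<open>f\<close>, ending at \<open>snd f\<close>; these
        differ, so there is no backtrack.\<close>
      define r where "r = rev_path (e # es) @ q"
      have r: "awalk v r v"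
        unfolding r_def using Cons.prems(1,3) by (intro awalk_appendI[of _ _ u]) (simp_all only: awalk_rev_path)
      have "nonbacktracking r"
        unfolding r_def nonbacktracking_append nonbacktracking_rev_path
        using Cons.prems q False by auto
      moreover have "\<not> distinct (awalk_verts v r)"
      proof
        assume "distinct (awalk_verts v r)"
        then have "apath v r v" using r by (simp add: apath_def)
        moreover have "r \<noteq> []" by (simp add: r_def q)
        ultimately show False using apath_nonempty_ends by blast
      qed
      ultimately obtain c where "undirected_cycle G c" "length c \<le> length r"
        using nonbacktracking_imp_cycle[OF r] by blast
      moreover have "length r \<le> N" using Cons.prems(5) by (simp add: r_def rev_path_conv)
      ultimately show ?thesis using no_cycle by fastforce
    qed
  qed
qed

text \<open>At equal distances, a shortest walk from \<open>u\<close> and the arc to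
  \<open>w\<close> followed by a shortest walk from \<open>w\<close> would be two non-backtracking
  walks of different lengths. Their total length is odd, twice the distance plus one, hence the
  strict bound.\<close>

lemma walk_dist_neighbour_neq:
  assumes no_cycle: "\<And>c. undirected_cycle G c \<Longrightarrow> N < length c"
    and "awalk u p v" "w \<in> neighbours G u" "2 * walk_dist G u v < N"
  shows "walk_dist G w v \<noteq> walk_dist G u v"
proof
  assume eq: "walk_dist G w v = walk_dist G u v"
  have arc: "(u, w) \<in> parcs G" using assms(3) by (simp add: neighbours_def)
  obtain q where q: "awalk u q v" "length q = walk_dist G u v" using shortest_walk[OF assms(2)] .
  obtain r where r: "awalk w r v" "length r = walk_dist G w v"
    using walk_dist_neighbour(3)[OF assms(2,3)] shortest_walk by blast
  \<comment> \<open>Otherwise the rest of \<open>r\<close> would be a walk from \<open>u\<close> to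
    \<open>v\<close> below the distance.\<close>
  have "snd (hd r) \<noteq> u" if "r \<noteq> []"
  proof
    assume "snd (hd r) = u"
    moreover obtain f s where "r = f # s" using \<open>r \<noteq> []\<close> by (cases r) auto
    ultimately have "awalk u s v" "length s < length r" using r by (auto simp: awalk_Cons_iff)
    with walk_dist_le[of u s v] r eq show False by simp
  qed
  then have "nonbacktracking ((u, w) # r)"
    using shortest_walk_nonbacktracking[OF r] by (auto simp: nonbacktracking_Cons)
  moreover have "awalk u ((u, w) # r) v" using arc r by (simp add: awalk_Cons_iff)
  ultimately have "q = (u, w) # r"
    using shortest_walk_nonbacktracking[OF q] q r eq assms(4)
    by (intro nonbacktracking_unique[OF no_cycle q(1)]) auto
  with q r eq show False by simp
qed

text \<open>Two closer neighbours would give two distinct shortest walks from \<open>u\<close>.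
  Their total length is only twice the distance, so distance \<open>N / 2\<close> itself is
  allowed.\<close>

lemma closer_neighbour_unique:
  assumes no_cycle: "\<And>c. undirected_cycle G c \<Longrightarrow> N < length c"
    and "awalk u p v" "0 < walk_dist G u v" "2 * walk_dist G u v \<le> N"
  obtains w where "w \<in> neighbours G u" "Suc (walk_dist G w v) = walk_dist G u v"
    "\<And>x. x \<in> neighbours G u \<Longrightarrow> x \<noteq> w \<Longrightarrow> walk_dist G u v \<le> walk_dist G x v"
proof -
  obtain q where q: "awalk u q v" "length q = walk_dist G u v" using shortest_walk[OF assms(2)] .
  then obtain e q' where "q = e # q'" using assms(3) by (cases q) auto
  with q obtain w where q': "q = (u, w) # q'" by (cases e) (auto simp: awalk_Cons_iff)
  have w: "w \<in> neighbours G u" using q q' by (auto simp: neighbours_def awalk_Cons_iff)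
  have "Suc (walk_dist G w v) = walk_dist G u v"
    using walk_dist_le[of w q' v] q q' walk_dist_neighbour(2)[OF assms(2) w]
    by (auto simp: awalk_Cons_iff)
  moreover have "walk_dist G u v \<le> walk_dist G x v" if x: "x \<in> neighbours G u" "x \<noteq> w" for x
  proof (rule ccontr)
    assume less: "\<not> ?thesis"
    obtain r where r: "awalk x r v" "length r = walk_dist G x v"
      using walk_dist_neighbour(3)[OF assms(2) x(1)] shortest_walk by blast
    have xr: "awalk u ((u, x) # r) v" using r x by (simp add: awalk_Cons_iff neighbours_def)
    moreover have len: "length ((u, x) # r) = walk_dist G u v"
      using r less walk_dist_neighbour(2)[OF assms(2) x(1)] by simp
    ultimately have "q = (u, x) # r"
      using shortest_walk_nonbacktracking[OF q] shortest_walk_nonbacktracking[OF xr len] q assms(4)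
      by (intro nonbacktracking_unique[OF no_cycle q(1)]) auto
    with q' x(2) show False by simp
  qed
  ultimately show thesis using that w by blast
qed

end

section \<open>Catalan's and Borel's triangle\<close>

text \<open>For \<open>i = k = 0\<close> the truncated subtraction yields the intended value \<open>1\<close>.\<close>

definition walk_poly :: "int \<Rightarrow> nat \<Rightarrow> nat \<Rightarrow> int" where
  "walk_poly d i k = (\<Sum>s\<le>i. int (catalan_triangle (i + k - 1) s) * (d - 1) ^ s * d ^ (i - s))"

lemma walk_poly_0 [simp]: "walk_poly d 0 k = 1"
  by (simp add: walk_poly_def)

text \<open>Mirrors the first step away from \<open>v\<close>, where all neighbours have distance 1.
  Both sides use row \<open>i\<close> of Catalan's triangle; the extra summand on the left lies
  above the diagonal and vanishes.\<close>

lemma walk_poly_Suc_0: "walk_poly d (Suc i) 0 = d * walk_poly d i 1"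
  by (simp add: walk_poly_def catalan_triangle_above sum_distrib_left Suc_diff_le mult_ac)

text \<open>Mirrors a first step to the one closer neighbour or to one of the \<open>d - 1\<close>
  farther ones. The Catalan recurrence gives it term by term once the equal summands for
  \<open>s = 0\<close> are split off.\<close>

lemma walk_poly_Suc_Suc:
  "walk_poly d (Suc i) (Suc k) = walk_poly d (Suc i) k + (d - 1) * walk_poly d i (Suc (Suc k))"
proof -
  have "(\<Sum>s\<le>i. int (catalan_triangle (Suc (i + k)) (Suc s)) * (d - 1) ^ Suc s * d ^ (i - s)) =
      (\<Sum>s\<le>i. int (catalan_triangle (i + k) (Suc s)) * (d - 1) ^ Suc s * d ^ (i - s)) +
      (d - 1) * (\<Sum>s\<le>i. int (catalan_triangle (Suc (i + k)) s) * (d - 1) ^ s * d ^ (i - s))"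
    unfolding sum_distrib_left sum.distrib[symmetric]
    by (intro sum.cong refl) (simp add: catalan_triangle_Suc_Suc algebra_simps)
  then show ?thesis
    by (simp add: walk_poly_def sum.atMost_Suc_shift del: sum.atMost_Suc power_Suc)
qed

lemma walk_poly_borel:
  "walk_poly d (Suc n) 0 =
     (\<Sum>k = 0..n. (-1) ^ k * int (borel_triangle n k) * d ^ (Suc n - k))"
proof -
  have binom: "(d - 1) ^ s = (\<Sum>k\<le>s. int (s choose k) * (-1) ^ k * d ^ (s - k))" for s
    using binomial_ring[of "-1" d s] by simp
  \<comment> \<open>The summand for \<open>s = Suc n\<close> is zero, being above the diagonal of
    row \<open>n\<close>.\<close>
  have "walk_poly d (Suc n) 0 = (\<Sum>s\<le>n. int (catalan_triangle n s) * (d - 1) ^ s * d ^ (Suc n - s))"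
    by (simp add: walk_poly_def catalan_triangle_above)
  also have "\<dots> = (\<Sum>s\<le>n. \<Sum>k\<le>s. int (s choose k) * int (catalan_triangle n s) * (-1) ^ k * d ^ (Suc n - k))"
    unfolding binom sum_distrib_left sum_distrib_right
    by (intro sum.cong refl) (auto simp: mult_ac simp flip: power_add)
  \<comment> \<open>Interchanging the sums over \<open>k \<le> s \<le> n\<close> makes the inner sum
    the defining sum of Borel's triangle.\<close>
  also have "\<dots> = (\<Sum>k\<le>n. \<Sum>s = k..n. int (s choose k) * int (catalan_triangle n s) * (-1) ^ k * d ^ (Suc n - k))"
    by (simp add: sum.Sigma)
      (rule sum.reindex_bij_witness[of _ prod.swap prod.swap]; auto simp: prod.swap_def)
  also have "\<dots> = (\<Sum>k = 0..n. (-1) ^ k * int (borel_triangle n k) * d ^ (Suc n - k))"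
    by (simp add: borel_triangle_def sum_distrib_left sum_distrib_right mult_ac atMost_atLeast0)
  finally show ?thesis .
qed

section \<open>Counting walks\<close>

text \<open>A walk of length \<open>k + 2 * i\<close> to \<open>v\<close> from distance
  \<open>k\<close> gets no farther from \<open>v\<close> than \<open>k + i\<close>, so the bound
  keeps it where the graph looks like a tree. A step towards \<open>v\<close> lowers
  \<open>k\<close> and keeps \<open>i\<close>; a step away raises \<open>k\<close> and lowers
  \<open>i\<close>, preserving \<open>k + i\<close>.\<close>

lemma (in pair_bidirected_digraph) card_walks:
  assumes no_cycle: "\<And>c. undirected_cycle G c \<Longrightarrow> 2 * n < length c"
    and reg: "regular G d"
    and "awalk u p v" "walk_dist G u v + i \<le> n"
  shows "int (card (walks G u v (walk_dist G u v + 2 * i))) = walk_poly (int d) i (walk_dist G u v)"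
  using assms(3,4)
proof (induction "walk_dist G u v + 2 * i" arbitrary: u p i)
  case 0
  then have "walk_dist G u v = 0" by simp
  with shortest_walk[OF 0(2)] obtain q where "awalk u q v" "length q = 0" by metis
  then show ?case using 0 by (auto simp: awalk_Nil_iff walks_0)
next
  case (Suc m)
  have u: "u \<in> pverts G" using Suc.prems(1) by auto
  note reach = walk_dist_neighbour(3)[OF Suc.prems(1)]
  let ?N = "neighbours G u"
  have step: "int (card (walks G u v (walk_dist G u v + 2 * i))) = (\<Sum>w\<in>?N. int (card (walks G w v m)))"
    using card_walks_Suc[OF reg u] Suc.hyps(2)[symmetric] by simp
  note N = regular_neighbours[OF reg u]
  show ?case
  proof (cases "walk_dist G u v")
    case 0
    then obtain j where i: "i = Suc j" using Suc.hyps(2) by (cases i) auto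
    have "int (card (walks G w v m)) = walk_poly (int d) j 1" if w: "w \<in> ?N" for w
    proof -
      have "walk_dist G w v = 1"
        using walk_dist_neighbour(1)[OF Suc.prems(1) w] 0 Suc.prems(2) i
          walk_dist_neighbour_neq[OF no_cycle Suc.prems(1) w] by simp
      moreover from this have "m = walk_dist G w v + 2 * j" using Suc.hyps(2) 0 i by simp
      moreover obtain q where "awalk w q v" using reach[OF w] ..
      ultimately show ?thesis using Suc.hyps(1)[of w j] Suc.prems(2) 0 i by auto
    qed
    then show ?thesis unfolding step using N 0 i by (simp add: walk_poly_Suc_0)
  next
    case k: (Suc k)
    obtain w where w: "w \<in> ?N" "Suc (walk_dist G w v) = walk_dist G u v"
        "\<And>x. x \<in> ?N \<Longrightarrow> x \<noteq> w \<Longrightarrow> walk_dist G u v \<le> walk_dist G x v"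
      using closer_neighbour_unique[OF no_cycle Suc.prems(1)] k Suc.prems(2) by auto
    obtain q where "awalk w q v" using reach[OF w(1)] ..
    then have cw: "int (card (walks G w v m)) = walk_poly (int d) i k"
      using Suc.hyps(1)[of w i q] Suc.hyps(2) Suc.prems(2) w(2) k by auto
    have split: "(\<Sum>x\<in>?N. int (card (walks G x v m))) =
        walk_poly (int d) i k + (\<Sum>x\<in>?N - {w}. int (card (walks G x v m)))"
      using sum.remove[OF N(1) w(1), of "\<lambda>x. int (card (walks G x v m))"] cw by linarith
    show ?thesis
    proof (cases i)
      case 0
      \<comment> \<open>With \<open>i = 0\<close> the remaining length \<open>m\<close> is one less
        than the distance of \<open>u\<close>, too short from any other neighbour.\<close>
      have "walks G x v m = {}" if "x \<in> ?N - {w}" for x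
        using w(3)[of x] that Suc.hyps(2) 0 by (intro walks_less_dist) auto
      then show ?thesis unfolding step split using 0 by simp
    next
      case i: (Suc j)
      have "int (card (walks G x v m)) = walk_poly (int d) j (Suc (Suc k))" if x: "x \<in> ?N - {w}" for x
      proof -
        have xN: "x \<in> ?N" using x by simp
        \<comment> \<open>Since \<open>i\<close> is positive, the distance of \<open>u\<close> is
          below \<open>n\<close>; this is the strict bound that excludes a neighbour at equal
          distance.\<close>
        have "walk_dist G x v = Suc (Suc k)"
          using walk_dist_neighbour(1)[OF Suc.prems(1) xN] w(3)[of x] x k Suc.prems(2) i
            walk_dist_neighbour_neq[OF no_cycle Suc.prems(1) xN] by simp
        moreover from this have "m = walk_dist G x v + 2 * j" using Suc.hyps(2) k i by simp
        moreover obtain q where "awalk x q v" using reach[OF xN] ..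
        ultimately show ?thesis using Suc.hyps(1)[of x j] Suc.prems(2) k i by auto
      qed
      moreover have "int (card (?N - {w})) = int d - 1"
        using N w(1) by (metis card_Suc_Diff1 add_diff_cancel_left' of_nat_Suc)
      ultimately show ?thesis unfolding step split using k i by (simp add: walk_poly_Suc_Suc)
    qed
  qed
qed

theorem theorem14:
  fixes G :: "'a pair_pre_digraph" and v :: 'a and n m \<delta> :: nat
  assumes "n \<ge> 1"
    and "pair_bidirected_digraph G"
    and "regular G \<delta>"
    and "(infinite (pverts G) \<and> undirected_tree G) \<or>
         (finite (pverts G) \<and> card (pverts G) = m \<and> girth G > enat (2 * n))"
    and "v \<in> pverts G"
  shows "int (card (closed_walks G v (2 * n))) =
           (\<Sum>l = 1..n. (-1) ^ (n - l) * int (borel_triangle (n - 1) (n - l)) * int \<delta> ^ l) \<and>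
         (\<Sum>l = 1..n. (-1) ^ (n - l) * int (borel_triangle (n - 1) (n - l)) * int \<delta> ^ l) =
           (\<Sum>l = 0..n - 1. (-1) ^ l * int (borel_triangle (n - 1) l) * int \<delta> ^ (n - l))"
proof -
  interpret pair_bidirected_digraph G by fact
  obtain j where n: "n = Suc j" using assms(1) by (cases n) auto
  have no_cycle: "2 * n < length c" if "undirected_cycle G c" for c
    using assms(4)
  proof
    assume "infinite (pverts G) \<and> undirected_tree G"
    with that show ?thesis by (auto simp: undirected_tree_def)
  next
    assume "finite (pverts G) \<and> card (pverts G) = m \<and> girth G > enat (2 * n)"
    moreover have "girth G \<le> enat (length c)"
      unfolding girth_def by (rule INF_lower) (simp add: that)
    ultimately have "enat (2 * n) < enat (length c)" by (meson order.strict_trans2)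
    then show ?thesis by simp
  qed
  have v: "awalk v [] v" using assms(5) by (simp add: awalk_Nil_iff)
  have "walk_dist G v v = 0" using walk_dist_le[OF v] by simp
  \<comment> \<open>The start \<open>v\<close> has distance 0, so \<open>i = n\<close> just meets
    the bound.\<close>
  with card_walks[OF no_cycle assms(3) v, where i = n]
  have "int (card (closed_walks G v (2 * n))) = walk_poly (int \<delta>) n 0"
    by (simp add: closed_walks_eq_walks)
  moreover have "(\<Sum>l = 1..n. (-1) ^ (n - l) * int (borel_triangle (n - 1) (n - l)) * int \<delta> ^ l) =
      (\<Sum>l = 0..n - 1. (-1) ^ l * int (borel_triangle (n - 1) l) * int \<delta> ^ (n - l))"
    by (rule sum.reindex_bij_witness[of _ "\<lambda>l. n - l" "\<lambda>l. n - l"]) (auto simp: n)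
  ultimately show ?thesis using walk_poly_borel[of "int \<delta>" j] by (simp add: n)
qed

end
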